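(* Let $t\ge7$ be an odd integer. Then $$\lim_{r\to\infty}\pi_{rt}(rC_t)=\frac12,$$ where $C_t$ is the cycle on $t$ vertices.
   Context: Graphs are finite and simple. An $m$-partite graph $G$ is a graph with a vertex partition $V = V_1\sqcup\dots\sqcup V_m$ into nonempty parts such that no edge has both ends in the same part. For disjoint nonempty vertex sets $X,Y$, the edge density is $d(X,Y) = \frac{e(X,Y)}{|X||Y|}$, where $e(X,Y)$ is the number of edges between $X$ and $Y$. The $m$-partite density of $G$ is $d_m(G) = \min_{1\le i<j\le m} d(V_i,V_j)$. A traversal of $G$ is a subgraph (on $m$ vertices) containing exactly one vertex from each part. For a graph $F$, $G$ contains an $F$-traversal if some traversal of $G$ contains $F$ as a subgraph (up to isomorphism). The critical density is $$\pi_m(F) = \sup\{\alpha\in[0,1] : \text{there exists an } m\text{-partite graph } G \text{ with } d_m(G)\ge\alpha \text{ and no } F\text{-traversal}\}.$$ $rC_t$ denotes the graph consisting of $r$ vertex-disjoint copies of $C_t$. *)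

theory Defs
  imports Complex_Main "HOL-Library.Disjoint_Sets"
begin

record 'a graph =
  verts :: "'a set"
  edges :: "'a set set"

definition simple_graph :: "'a graph \<Rightarrow> bool" where
  "simple_graph G \<longleftrightarrow>
     finite (verts G) \<and> (\<forall>e\<in>edges G. e \<subseteq> verts G \<and> card e = 2)"

definition subgraph :: "'a graph \<Rightarrow> 'a graph \<Rightarrow> bool" where
  "subgraph H G \<longleftrightarrow> simple_graph H \<and> verts H \<subseteq> verts G \<and> edges H \<subseteq> edges G"

definition isomorphic :: "'a graph \<Rightarrow> 'b graph \<Rightarrow> bool" where
  "isomorphic F K \<longleftrightarrow>
     (\<exists>f. bij_betw f (verts F) (verts K) \<and> edges K = (\<lambda>e. f ` e) ` edges F)"

text \<open>Containment as a not necessarily induced subgraph, up to isomorphism.\<close>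

definition contains_copy :: "'b graph \<Rightarrow> 'a graph \<Rightarrow> bool" where
  "contains_copy F H \<longleftrightarrow> (\<exists>K. subgraph K H \<and> isomorphic F K)"

text \<open>The partition is part of the data of an \<open>m\<close>-partite graph; its parts are
  \<open>V 1, \<dots>, V m\<close>, and the values of \<open>V\<close> outside \<open>{1..m}\<close> are irrelevant.\<close>

definition multipartite :: "nat \<Rightarrow> (nat \<Rightarrow> 'a set) \<Rightarrow> 'a graph \<Rightarrow> bool" where
  "multipartite m V G \<longleftrightarrow>
     simple_graph G \<and>
     verts G = (\<Union>i\<in>{1..m}. V i) \<and>
     disjoint_family_on V {1..m} \<and>
     (\<forall>i\<in>{1..m}. V i \<noteq> {}) \<and>
     (\<forall>e\<in>edges G. \<forall>i\<in>{1..m}. \<not> e \<subseteq> V i)"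

definition edges_between :: "'a graph \<Rightarrow> 'a set \<Rightarrow> 'a set \<Rightarrow> 'a set set" where
  "edges_between G X Y = {e \<in> edges G. \<exists>x\<in>X. \<exists>y\<in>Y. e = {x, y}}"

definition edge_density :: "'a graph \<Rightarrow> 'a set \<Rightarrow> 'a set \<Rightarrow> real" where
  "edge_density G X Y = real (card (edges_between G X Y)) / (real (card X) * real (card Y))"

text \<open>Meaningful for \<open>m \<ge> 2\<close> only: otherwise this is a minimum over the empty set.\<close>

definition partite_density :: "nat \<Rightarrow> (nat \<Rightarrow> 'a set) \<Rightarrow> 'a graph \<Rightarrow> real" where
  "partite_density m V G =
     Min {edge_density G (V i) (V j) | i j. 1 \<le> i \<and> i < j \<and> j \<le> m}"

definition traversal :: "nat \<Rightarrow> (nat \<Rightarrow> 'a set) \<Rightarrow> 'a graph \<Rightarrow> 'a graph \<Rightarrow> bool" where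
  "traversal m V G T \<longleftrightarrow> subgraph T G \<and> (\<forall>i\<in>{1..m}. \<exists>!v. v \<in> verts T \<inter> V i)"

definition has_traversal :: "'b graph \<Rightarrow> nat \<Rightarrow> (nat \<Rightarrow> 'a set) \<Rightarrow> 'a graph \<Rightarrow> bool" where
  "has_traversal F m V G \<longleftrightarrow> (\<exists>T. traversal m V G T \<and> contains_copy F T)"

text \<open>Every finite graph is isomorphic to one with vertices in \<open>nat\<close>, so restricting \<open>G\<close>
  to that vertex type loses nothing.\<close>

definition critical_density :: "nat \<Rightarrow> 'b graph \<Rightarrow> real" where
  "critical_density m F =
     Sup {\<alpha> \<in> {0..1}. \<exists>(G :: nat graph) V.
            multipartite m V G \<and> partite_density m V G \<ge> \<alpha> \<and> \<not> has_traversal F m V G}"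

text \<open>The cycle on \<open>t\<close> vertices, for \<open>t \<ge> 3\<close>.\<close>

definition cycle_graph :: "nat \<Rightarrow> nat graph" where
  "cycle_graph t = \<lparr>verts = {0..<t}, edges = (\<lambda>i. {i, (i + 1) mod t}) ` {0..<t}\<rparr>"

definition disjoint_copies :: "nat \<Rightarrow> 'a graph \<Rightarrow> (nat \<times> 'a) graph" where
  "disjoint_copies r F =
     \<lparr>verts = {0..<r} \<times> verts F, edges = {Pair k ` e | k e. k < r \<and> e \<in> edges F}\<rparr>"

end

theory Submission
  imports Defs "HOL-Library.Ramsey"
begin

text \<open>
  Splitting every part into two halves and joining opposite halves of different parts gives a
  bipartite graph of density 1/2, hence the lower bound. For the upper bound let all densities be at least
  \<open>1/2 + \<epsilon>\<close>. First, every part lies in a cycle \<open>C\<^sub>t\<close> through any sufficiently large family of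
  further parts. Fix a vertex \<open>u\<close> of the given part with many neighbours and choose one vertex
  at random from each of the other parts. By a second moment argument some choice spans a graph on
  \<open>n\<close> vertices with more than \<open>(1/2 + \<epsilon>/2) n\<^sup>2\<close> ordered edges in which at least \<open>n/2\<close> vertices (the
  set \<open>A\<close>) are neighbours of \<open>u\<close>. Let \<open>X\<close> be the set of vertices with many neighbours in \<open>A\<close> and
  \<open>Y\<close> the set of those with many neighbours in \<open>X\<close>. If one of \<open>A\<close>, \<open>X\<close>, \<open>Y\<close> spans a dense graph, a
  path inside it extends to a path on \<open>t - 1\<close> vertices with both ends in \<open>A\<close>; otherwise the edge
  count is at most about \<open>n\<^sup>2/2\<close>.

  Call a set of \<open>t\<close> parts good if it has a \<open>C\<^sub>t\<close>-traversal. By Ramsey's theorem there is a large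
  reserve of parts all of whose \<open>t\<close>-subsets are good. Tile the rest greedily up to a bounded
  remainder, cover each remaining part using \<open>t - 1\<close> parts of the reserve, and split what is left of
  the reserve arbitrarily.
\<close>

section \<open>Paths with both ends in a large vertex set\<close>

text \<open>Ordered pairs: for symmetric \<open>R\<close>, an edge joining two distinct vertices of
  \<open>S\<close> counts twice in \<open>adj R S S\<close>.\<close>

definition adj :: "('a \<Rightarrow> 'a \<Rightarrow> bool) \<Rightarrow> 'a set \<Rightarrow> 'a set \<Rightarrow> ('a \<times> 'a) set" where
  "adj R S T = {(u, v). u \<in> S \<and> v \<in> T \<and> R u v}"

lemma finite_adj: "finite S \<Longrightarrow> finite T \<Longrightarrow> finite (adj R S T)"
  by (rule finite_subset[of _ "S \<times> T"]) (auto simp: adj_def)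

lemma card_adj_swap:
  assumes "symp R"
  shows "card (adj R S T) = card (adj R T S)"
proof -
  have "adj R T S = prod.swap ` adj R S T"
    using assms by (force simp: adj_def symp_def)
  then show ?thesis
    by (simp add: card_image)
qed

lemma card_adj_le:
  fixes h :: real
  assumes "finite S" "finite T" "\<And>u. u \<in> S \<Longrightarrow> card {v \<in> T. R u v} \<le> h"
  shows "card (adj R S T) \<le> h * card S"
proof -
  have "adj R S T = (SIGMA u:S. {v \<in> T. R u v})"
    by (auto simp: adj_def)
  then have "real (card (adj R S T)) = (\<Sum>u\<in>S. real (card {v \<in> T. R u v}))"
    using assms by simp
  also have "\<dots> \<le> h * card S"
    using sum_bounded_above[of S "\<lambda>u. real (card {v \<in> T. R u v})" h] assms by (simp add: mult.commute)
  finally show ?thesis .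
qed

text \<open>Deleting a vertex with fewer than \<open>h\<close> neighbours destroys fewer than
  \<open>2 * h\<close> ordered pairs, so the density hypothesis survives, even strictly. Strictness
  rules out the empty set, so the deletions end at a nonempty set in which no such vertex is
  left.\<close>

lemma min_degree_subset:
  fixes h :: real
  assumes "symp R" "finite S" "S \<noteq> {}" "h > 0" "card (adj R S S) \<ge> 2 * h * card S"
  shows "\<exists>S'\<subseteq>S. S' \<noteq> {} \<and> (\<forall>u\<in>S'. card {v \<in> S'. R u v} \<ge> h)"
  using assms(2,3,5)
proof (induction "card S" arbitrary: S rule: less_induct)
  case less
  show ?case
  proof (cases "\<forall>u\<in>S. card {v \<in> S. R u v} \<ge> h")
    case True
    then show ?thesis using less.prems by blast
  next
    case False
    then obtain u where u: "u \<in> S" "card {v \<in> S. R u v} < h"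
      by force
    let ?S = "S - {u}"
    have "adj R S S \<subseteq> adj R ?S ?S \<union> Pair u ` {v \<in> S. R u v} \<union> (\<lambda>v. (v, u)) ` {v \<in> S. R u v}"
      using \<open>symp R\<close> by (auto simp: adj_def symp_def)
    then have "card (adj R S S)
        \<le> card (adj R ?S ?S \<union> Pair u ` {v \<in> S. R u v} \<union> (\<lambda>v. (v, u)) ` {v \<in> S. R u v})"
      using less.prems by (intro card_mono) (auto simp: finite_adj)
    also have "\<dots> \<le> card (adj R ?S ?S) + card (Pair u ` {v \<in> S. R u v})
        + card ((\<lambda>v. (v, u)) ` {v \<in> S. R u v})"
      by (meson add_le_mono1 card_Un_le le_trans)
    also have "\<dots> \<le> card (adj R ?S ?S) + card {v \<in> S. R u v} + card {v \<in> S. R u v}"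
      using less.prems by (intro add_mono card_image_le) auto
    finally have "card (adj R S S) < card (adj R ?S ?S) + 2 * h"
      using u by linarith
    moreover have "card S = Suc (card ?S)"
      using u less.prems by (simp only: card_Suc_Diff1)
    then have "card ?S < card S" and "real (card S) = real (card ?S) + 1"
      by linarith+
    ultimately have ge: "card (adj R ?S ?S) > 2 * h * card ?S"
      using less.prems(3) by (simp add: algebra_simps)
    have "?S \<noteq> {}"
    proof
      assume "?S = {}"
      with ge show False by (simp add: adj_def)
    qed
    then obtain S' where "S' \<subseteq> ?S" "S' \<noteq> {}" "\<forall>u\<in>S'. card {v \<in> S'. R u v} \<ge> h"
      using less.hyps[OF \<open>card ?S < card S\<close>] ge less.prems(1) by auto
    then show ?thesis by blast
  qed
qed

text \<open>Greedy extension at the last vertex: it has at least \<open>k\<close> neighbours in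
  \<open>S\<close>, and a path on fewer than \<open>k\<close> vertices cannot contain them
  all.\<close>

lemma min_degree_path:
  assumes "finite S" "S \<noteq> {}" "\<And>u. u \<in> S \<Longrightarrow> card {v \<in> S. R u v} \<ge> k" "1 \<le> l" "l \<le> k"
  shows "\<exists>p. length p = l \<and> distinct p \<and> set p \<subseteq> S \<and> successively R p"
  using assms(4,5)
proof (induction l rule: dec_induct)
  case base
  from assms(2) obtain u where "u \<in> S" by blast
  then show ?case by (intro exI[of _ "[u]"]) auto
next
  case (step l)
  then obtain p where p: "length p = l" "distinct p" "set p \<subseteq> S" "successively R p"
    by auto
  then have "p \<noteq> []" using step by auto
  then have "last p \<in> S" using p last_in_set by blast
  then have "card {v \<in> S. R (last p) v} > card (set p)"
    using assms(3)[of "last p"] step p by (simp add: distinct_card)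
  then have "\<not> {v \<in> S. R (last p) v} \<subseteq> set p"
    by (metis List.finite_set card_mono not_le)
  then obtain v where "v \<in> S" "R (last p) v" "v \<notin> set p" by blast
  then show ?case using p
    by (intro exI[of _ "p @ [v]"]) (auto simp: successively_append_iff)
qed

text \<open>One new vertex of \<open>B\<close> is attached at each end. \<open>B\<close> may meet
  \<open>p\<close>, so the second new vertex has to avoid \<open>length p + 1\<close> vertices;
  hence the degree bound.\<close>

lemma extend_path:
  assumes "symp R" "p \<noteq> []" "distinct p" "successively R p"
    "card {v \<in> B. R (hd p) v} \<ge> length p + 2" "card {v \<in> B. R (last p) v} \<ge> length p + 2"
  shows "\<exists>q. length q = length p + 2 \<and> distinct q \<and> set q \<subseteq> B \<union> set p \<and> successively R q
    \<and> hd q \<in> B \<and> last q \<in> B"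
proof -
  have "\<not> {v \<in> B. R (hd p) v} \<subseteq> set p"
    using card_mono[of "set p" "{v \<in> B. R (hd p) v}"] assms(3,5) by (auto simp: distinct_card)
  then obtain a where a: "a \<in> B" "R (hd p) a" "a \<notin> set p" by blast
  have "card (insert a (set p)) \<le> length p + 1"
    using assms(3) a by (simp add: distinct_card)
  then have "\<not> {v \<in> B. R (last p) v} \<subseteq> insert a (set p)"
    using card_mono[of "insert a (set p)" "{v \<in> B. R (last p) v}"] assms(6) by auto
  then obtain b where b: "b \<in> B" "R (last p) b" "b \<notin> insert a (set p)" by blast
  have "R a (hd p)" using a assms(1) by (auto simp: symp_def)
  then show ?thesis using a b assms(2-4)
    by (intro exI[of _ "a # p @ [b]"]) (auto simp: successively_append_iff successively_Cons)
qed

text \<open>Density is measured against \<open>card I\<close> instead of \<open>card S\<close>, so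
  that one threshold serves several subsets of \<open>I\<close>; it also forces \<open>S\<close> to
  be nonempty.\<close>

lemma dense_path:
  fixes h :: real
  assumes "symp R" "finite I" "I \<noteq> {}" "S \<subseteq> I" "h > 0" "card (adj R S S) \<ge> 2 * h * card I" "1 \<le> l" "l \<le> h"
  shows "\<exists>p. length p = l \<and> distinct p \<and> set p \<subseteq> S \<and> successively R p"
proof -
  have fin: "finite S" using assms finite_subset by blast
  have "card S \<le> card I" using assms card_mono by blast
  then have "2 * h * card S \<le> 2 * h * card I"
    using assms by simp
  then have "card (adj R S S) \<ge> 2 * h * card S" using assms by linarith
  moreover have "card I > 0" using assms by (simp add: card_gt_0_iff)
  then have "card (adj R S S) > 0"
    using assms(5,6) by (metis less_le_trans mult_pos_pos of_nat_0_less_iff zero_less_numeral)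
  then have "S \<noteq> {}" by (auto simp: adj_def)
  ultimately obtain S' where S': "S' \<subseteq> S" "S' \<noteq> {}" "\<forall>u\<in>S'. card {v \<in> S'. R u v} \<ge> h"
    using min_degree_subset[OF assms(1) fin _ assms(5)] by blast
  have "\<exists>p. length p = l \<and> distinct p \<and> set p \<subseteq> S' \<and> successively R p"
  proof (rule min_degree_path[where k = l])
    show "finite S'" using S' fin finite_subset by blast
    show "l \<le> card {v \<in> S'. R u v}" if "u \<in> S'" for u
      using S'(3) that assms(8) by (meson le_trans of_nat_le_iff order_trans)
  qed (use S' assms in auto)
  then show ?thesis using S'(1) by blast
qed

text \<open>The left side counts ordered pairs when four classes of sizes \<open>a\<close>,
  \<open>x\<close>, \<open>y\<close>, \<open>z\<close> are joined only consecutively and the last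
  one also to itself.\<close>

lemma four_part_bound:
  fixes a x y z n :: real
  assumes "a \<ge> n / 2" "x \<ge> 0" "y \<ge> 0" "z \<ge> 0" "a + x + y + z = n"
  shows "2 * a * x + 2 * x * y + 2 * y * z + z * z \<le> n * n / 2"
proof -
  define u where "u = n - 2 * x"
  \<comment> \<open>After \<open>a\<close> is eliminated the terms in \<open>x * y\<close> cancel,
    and \<open>y\<close> survives only in \<open>2 * y * z\<close>. The lower bound on
    \<open>a\<close> caps \<open>y\<close>, and the deficit to \<open>n * n / 2\<close> becomes a
    sum of nonnegative terms.\<close>
  have yb: "y \<le> n / 2 - x - z" using assms by linarith
  have a: "a = n - x - y - z" using assms by linarith
  have "y * z \<le> (n / 2 - x - z) * z" using yb assms by (simp add: mult_right_mono)
  then have "2 * a * x + 2 * x * y + 2 * y * z + z * z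
      \<le> 2 * (n - x - z) * x + (n - 2 * x - 2 * z) * z + z * z"
    unfolding a by (simp add: algebra_simps)
  also have "\<dots> = n * n / 2 - ((u - z) * (u - z) + z * z) / 2 - 2 * (x * z)"
    unfolding u_def by (simp add: field_simps)
  also have "\<dots> \<le> n * n / 2"
  proof -
    have decr: "c - p - q \<le> c" if "p \<ge> 0" "q \<ge> 0" for c p q :: real
      using that by linarith
    show ?thesis by (rule decr) (use assms in simp_all)
  qed
  finally show ?thesis .
qed

lemma card_Union_list_le: "card (\<Union> (set xs)) \<le> sum_list (map card xs)"
proof (induction xs)
  case (Cons x xs)
  then show ?case using card_Un_le[of x "\<Union> (set xs)"] by simp
qed simp

text \<open>A path inside \<open>X\<close> grows by a vertex of \<open>A\<close> at each end, one
  inside \<open>Y\<close> first by \<open>X\<close> and then by \<open>A\<close>. So paths on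
  \<open>l\<close>, \<open>l - 2\<close> or \<open>l - 4\<close> vertices in \<open>A\<close>,
  \<open>X\<close> or \<open>Y\<close> suffice, and \<open>5 \<le> l\<close> keeps the last number
  positive. If all three sets are sparse, too few places for edges remain, against
  \<open>dense\<close>.\<close>

lemma path_between_large_set:
  fixes h :: real
  assumes "symp R" "finite I" "I \<noteq> {}" "A \<subseteq> I" "card A \<ge> card I / 2" "5 \<le> l" "l \<le> h"
    and dense: "card (adj R I I) > card I * card I / 2 + 10 * h * card I"
  shows "\<exists>p. length p = l \<and> distinct p \<and> set p \<subseteq> I \<and> successively R p \<and> hd p \<in> A \<and> last p \<in> A"
proof -
  define X where "X = {v \<in> I. card {u \<in> A. R v u} \<ge> h}"
  define Y where "Y = {v \<in> I. card {u \<in> X. R v u} \<ge> h}"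
  have sub: "X \<subseteq> I" "Y \<subseteq> I" by (auto simp: X_def Y_def)
  have fin: "finite A" "finite X" "finite Y"
    using sub assms(2,4) finite_subset by blast+
  have h: "h > 0" using assms by linarith
  have X: "card {u \<in> A. R v u} \<ge> l" if "v \<in> X" for v
    using that assms(7) by (simp add: X_def)
  have Y: "card {u \<in> X. R v u} \<ge> l" if "v \<in> Y" for v
    using that assms(7) by (simp add: Y_def)
  have extX: "\<exists>q. length q = length p + 2 \<and> distinct q \<and> set q \<subseteq> I \<and> successively R q
      \<and> hd q \<in> A \<and> last q \<in> A"
    if "p \<noteq> []" "distinct p" "set p \<subseteq> I" "successively R p" "hd p \<in> X" "last p \<in> X" "length p + 2 \<le> l" for p
    using extend_path[OF assms(1) that(1,2,4), of A] X[OF that(5)] X[OF that(6)] that(3,7) assms(4)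
    by fastforce
  consider "card (adj R A A) \<ge> 2 * h * card I" | "card (adj R X X) \<ge> 2 * h * card I"
    | "card (adj R Y Y) \<ge> 2 * h * card I"
    | "card (adj R A A) < 2 * h * card I" "card (adj R X X) < 2 * h * card I"
      "card (adj R Y Y) < 2 * h * card I"
    by linarith
  then show ?thesis
  proof cases
    case 1
    obtain p where p: "length p = l" "distinct p" "set p \<subseteq> A" "successively R p"
      using dense_path[OF assms(1-4) h 1, of l] assms by auto
    then have "p \<noteq> []" using assms by auto
    then have "hd p \<in> A" "last p \<in> A" using p hd_in_set last_in_set by blast+
    then show ?thesis using p assms(4) by blast
  next
    case 2
    obtain p where p: "length p = l - 2" "distinct p" "set p \<subseteq> X" "successively R p"
      using dense_path[OF assms(1-3) sub(1) h 2, of "l - 2"] assms(6,7) by fastforce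
    then have "p \<noteq> []" using assms by auto
    moreover from this have "hd p \<in> X" "last p \<in> X" using p hd_in_set last_in_set by blast+
    moreover have "length p + 2 = l" "set p \<subseteq> I" using p sub assms(6) by auto
    ultimately show ?thesis using extX[of p] p by (metis le_refl)
  next
    case 3
    obtain p where p: "length p = l - 4" "distinct p" "set p \<subseteq> Y" "successively R p"
      using dense_path[OF assms(1-3) sub(2) h 3, of "l - 4"] assms(6,7) by fastforce
    then have ne: "p \<noteq> []" using assms by auto
    then have "hd p \<in> Y" "last p \<in> Y" using p hd_in_set last_in_set by blast+
    then have "length p + 2 \<le> card {v \<in> X. R (hd p) v}" "length p + 2 \<le> card {v \<in> X. R (last p) v}"
      using Y[of "hd p"] Y[of "last p"] p(1) assms(6) by linarith+
    from extend_path[OF assms(1) ne p(2,4) this]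
    obtain q where q: "length q = length p + 2" "distinct q" "set q \<subseteq> X \<union> set p" "successively R q"
        "hd q \<in> X" "last q \<in> X" by blast
    have "q \<noteq> []" using q by auto
    moreover have "length q + 2 = l" "set q \<subseteq> I" using p q sub assms(6) by auto
    ultimately show ?thesis using extX[of q] q by (metis le_refl)
  next
    case 4
    \<comment> \<open>\<open>X\<close> and \<open>Y\<close> may overlap \<open>A\<close> and each
      other. Assigning each vertex to the first of \<open>A\<close>, \<open>X\<close>,
      \<open>Y\<close> that contains it gives a partition of \<open>I\<close> with remainder
      \<open>Z\<close>.\<close>
    define X' where "X' = X - A"
    define Y' where "Y' = Y - A - X"
    define Z where "Z = I - A - X - Y"
    note ff = finite_adj assms(2) fin
    have fin': "finite X'" "finite Y'" "finite Z"
      using fin assms(2) by (auto simp: X'_def Y'_def Z_def)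
    \<comment> \<open>A vertex outside \<open>X\<close> sees fewer than \<open>h\<close> vertices of
      \<open>A\<close>; \<open>XY\<close> is the same for \<open>Y\<close> and
      \<open>X\<close>.\<close>
    have AX: "card (adj R A (I - X)) \<le> h * card I" "card (adj R (I - X) A) \<le> h * card I"
    proof -
      have "card (adj R (I - X) A) \<le> h * card (I - X)"
        using assms(2) fin by (intro card_adj_le) (auto simp: X_def)
      also have "\<dots> \<le> h * card I" using h assms(2) by (simp add: card_mono)
      finally show "card (adj R (I - X) A) \<le> h * card I" .
      then show "card (adj R A (I - X)) \<le> h * card I" using card_adj_swap[OF assms(1)] by metis
    qed
    have XY: "card (adj R X (I - Y)) \<le> h * card I" "card (adj R (I - Y) X) \<le> h * card I"
    proof -
      have "card (adj R (I - Y) X) \<le> h * card (I - Y)"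
        using assms(2) fin by (intro card_adj_le) (auto simp: Y_def)
      also have "\<dots> \<le> h * card I" using h assms(2) by (simp add: card_mono)
      finally show "card (adj R (I - Y) X) \<le> h * card I" .
      then show "card (adj R X (I - Y)) \<le> h * card I" using card_adj_swap[OF assms(1)] by metis
    qed
    \<comment> \<open>Origin of the constant 10: three sets of fewer than
      \<open>2 * h * card I\<close> pairs and four of at most \<open>h * card I\<close>. All other
      edges are confined to the products in \<open>?many\<close>, whose sizes
      \<open>four_part_bound\<close> controls.\<close>
    let ?few = "[adj R A A, adj R X X, adj R Y Y, adj R A (I - X), adj R (I - X) A, adj R X (I - Y), adj R (I - Y) X]"
    let ?many = "[A \<times> X', X' \<times> A, X' \<times> Y', Y' \<times> X', Y' \<times> Z, Z \<times> Y', Z \<times> Z]"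
    have "adj R I I \<subseteq> \<Union> (set (?few @ ?many))"
    proof
      fix w assume "w \<in> adj R I I"
      then obtain u v where w: "w = (u, v)" "u \<in> I" "v \<in> I" "R u v" by (auto simp: adj_def)
      then show "w \<in> \<Union> (set (?few @ ?many))"
        by (cases "u \<in> A"; cases "u \<in> X"; cases "u \<in> Y"; cases "v \<in> A"; cases "v \<in> X"; cases "v \<in> Y";
            simp add: adj_def X'_def Y'_def Z_def)
    qed
    then have "card (adj R I I) \<le> card (\<Union> (set (?few @ ?many)))"
      using fin' ff by (intro card_mono) auto
    also have "\<dots> \<le> sum_list (map card (?few @ ?many))"
      by (rule card_Union_list_le)
    finally have "real (card (adj R I I)) \<le> real (sum_list (map card (?few @ ?many)))"
      by (simp only: of_nat_le_iff)
    also have "\<dots> = real (sum_list (map card ?few)) + real (sum_list (map card ?many))"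
      by simp
    also have "real (sum_list (map card ?few)) \<le> 10 * h * card I"
      using 4 AX XY by simp
    also have "real (sum_list (map card ?many))
        = 2 * card A * card X' + 2 * card X' * card Y' + 2 * card Y' * card Z + card Z * card Z"
      by (simp add: card_cartesian_product algebra_simps)
    also have "\<dots> \<le> card I * card I / 2"
    proof -
      have "card I = card (A \<union> (X' \<union> (Y' \<union> Z)))"
        using assms(4) sub by (intro arg_cong[of _ _ card]) (auto simp: X'_def Y'_def Z_def)
      also have "\<dots> = card A + (card X' + (card Y' + card Z))"
        using fin fin' by (subst card_Un_disjoint, auto simp: X'_def Y'_def Z_def)+
      finally show ?thesis
        using four_part_bound[of "card I" "card A" "card X'" "card Y'" "card Z"] assms(5) by simp
    qed
    finally show ?thesis using dense by simp
  qed
qed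

section \<open>Random transversals\<close>

text \<open>Expectation over independent uniform choices \<open>x i \<in> W i\<close>; extensional
  functions keep the sample space finite for finite \<open>I\<close> and \<open>W i\<close>.\<close>

definition mean :: "'i set \<Rightarrow> ('i \<Rightarrow> 'a set) \<Rightarrow> (('i \<Rightarrow> 'a) \<Rightarrow> real) \<Rightarrow> real" where
  "mean I W f = (\<Sum>x\<in>PiE I W. f x) / card (PiE I W)"

lemma mean_diff: "mean I W (\<lambda>x. f x - g x) = mean I W f - mean I W g"
  and mean_scale: "mean I W (\<lambda>x. c * f x) = c * mean I W f"
  by (simp_all add: mean_def sum_subtractf diff_divide_distrib
      flip: sum_distrib_left)

lemma mean_sum: "mean I W (\<lambda>x. \<Sum>k\<in>K. f k x) = (\<Sum>k\<in>K. mean I W (f k))"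
  unfolding mean_def by (simp add: sum.swap[of _ K] sum_divide_distrib)

lemma sum_PiE_insert:
  assumes "i \<notin> S"
  shows "(\<Sum>x\<in>PiE (insert i S) W. f x) = (\<Sum>u\<in>W i. \<Sum>g\<in>PiE S W. f (g(i := u)))"
proof -
  have "inj_on (\<lambda>(y, g). g(i := y)) (W i \<times> PiE S W)"
    using assms by (rule inj_combinator)
  then show ?thesis
    unfolding PiE_insert_eq by (simp add: sum.reindex sum.cartesian_product case_prod_unfold)
qed

context
  fixes I :: "'i set" and W :: "'i \<Rightarrow> 'a set"
  assumes fin: "finite I" "\<And>i. i \<in> I \<Longrightarrow> finite (W i)" and ne: "\<And>i. i \<in> I \<Longrightarrow> W i \<noteq> {}"
begin

lemma exists_ge_mean: "\<exists>x\<in>PiE I W. f x \<ge> mean I W f"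
proof (rule ccontr)
  assume "\<not> ?thesis"
  then have *: "f x < mean I W f" if "x \<in> PiE I W" for x
    using that by force
  have "finite (PiE I W)" "PiE I W \<noteq> {}"
    using fin ne by (auto simp: finite_PiE PiE_eq_empty_iff)
  then have "(\<Sum>x\<in>PiE I W. f x) < (\<Sum>x\<in>PiE I W. mean I W f)" and "card (PiE I W) > 0"
    using * by (auto intro!: sum_strict_mono simp only: card_gt_0_iff)
  then show False by (simp add: mean_def)
qed

lemma mean_one_coordinate:
  assumes "i \<in> I"
  shows "mean I W (\<lambda>x. g (x i)) = (\<Sum>u\<in>W i. g u) / card (W i)"
proof -
  define S where "S = I - {i}"
  have I: "I = insert i S" "i \<notin> S" using assms by (auto simp: S_def)
  have S: "finite S" "\<And>j. j \<in> S \<Longrightarrow> finite (W j)" "\<And>j. j \<in> S \<Longrightarrow> W j \<noteq> {}"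
    using fin ne I by auto
  then have "card (PiE S W) > 0"
    by (auto simp: card_gt_0_iff finite_PiE PiE_eq_empty_iff)
  moreover have "card (PiE I W) = card (W i) * card (PiE S W)"
    using S I by (simp add: card_PiE)
  moreover have "(\<Sum>x\<in>PiE I W. g (x i)) = (\<Sum>u\<in>W i. g u) * card (PiE S W)"
    unfolding I(1) sum_PiE_insert[OF I(2)] by (simp add: sum_distrib_right mult.commute)
  ultimately show ?thesis by (simp add: mean_def)
qed

text \<open>The remaining coordinates contribute a common factor that cancels. Joint uniformity of
  pairs of coordinates is all the independence that the second moment argument uses.\<close>

lemma mean_two_coordinates:
  assumes "i \<in> I" "j \<in> I" "i \<noteq> j"
  shows "mean I W (\<lambda>x. g (x i) (x j)) = (\<Sum>u\<in>W i. \<Sum>v\<in>W j. g u v) / (card (W i) * card (W j))"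
proof -
  define S where "S = I - {i, j}"
  have I: "I = insert i (insert j S)" "i \<notin> insert j S" "j \<notin> S"
    using assms by (auto simp: S_def)
  have S: "finite S" "\<And>j. j \<in> S \<Longrightarrow> finite (W j)" "\<And>j. j \<in> S \<Longrightarrow> W j \<noteq> {}"
    using fin ne I by auto
  then have "card (PiE S W) > 0"
    by (auto simp: card_gt_0_iff finite_PiE PiE_eq_empty_iff)
  moreover have "card (PiE I W) = card (W i) * card (W j) * card (PiE S W)"
    using S I by (simp add: card_PiE)
  moreover have "(\<Sum>x\<in>PiE I W. g (x i) (x j)) = (\<Sum>u\<in>W i. \<Sum>v\<in>W j. g u v) * card (PiE S W)"
    unfolding I(1) sum_PiE_insert[OF I(2)] sum_PiE_insert[OF I(3)] using assms(3)
    by (simp add: mult.commute[of "sum _ _"] flip: sum_distrib_left)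
  ultimately show ?thesis by (simp add: mean_def)
qed

text \<open>Variance of a sum of independent variables in \<open>[0, 1]\<close>: the covariances
  vanish and each of the \<open>card I\<close> diagonal terms is at most 1.\<close>

lemma mean_square_deviation:
  fixes b :: "'i \<Rightarrow> 'a \<Rightarrow> real"
  assumes "\<And>i u. i \<in> I \<Longrightarrow> u \<in> W i \<Longrightarrow> 0 \<le> b i u \<and> b i u \<le> 1"
  shows "mean I W (\<lambda>x. (\<Sum>i\<in>I. b i (x i) - (\<Sum>u\<in>W i. b i u) / card (W i))\<^sup>2) \<le> card I"
proof -
  define m where "m i = (\<Sum>u\<in>W i. b i u) / card (W i)" for i
  have pos: "card (W i) > 0" if "i \<in> I" for i
    using fin ne that by (auto simp: card_gt_0_iff)
  have m: "0 \<le> m i" "m i \<le> 1" if "i \<in> I" for i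
  proof -
    show "0 \<le> m i" unfolding m_def using assms that by (intro divide_nonneg_nonneg sum_nonneg) auto
    have "(\<Sum>u\<in>W i. b i u) \<le> card (W i)" using sum_bounded_above[of "W i" "b i" 1] assms that by auto
    then show "m i \<le> 1" unfolding m_def using pos[OF that] by simp
  qed
  have c: "mean I W (\<lambda>x. (b i (x i) - m i) * (b j (x j) - m j)) \<le> (if i = j then 1 else 0)"
    if "i \<in> I" "j \<in> I" for i j
  proof (cases "i = j")
    case True
    have "(b i u - m i) * (b i u - m i) \<le> 1" if "u \<in> W i" for u
    proof -
      have "\<bar>b i u - m i\<bar> \<le> 1" using m[OF \<open>i \<in> I\<close>] assms[OF \<open>i \<in> I\<close> that] by linarith
      then show ?thesis by (simp add: abs_square_le_1 flip: power2_eq_square)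
    qed
    then have "(\<Sum>u\<in>W i. (b i u - m i) * (b i u - m i)) \<le> card (W i)"
      using sum_bounded_above[of "W i" "\<lambda>u. (b i u - m i) * (b i u - m i)" 1] by auto
    then show ?thesis
      using True pos[OF that(1)]
        mean_one_coordinate[OF that(1), where g = "\<lambda>u. (b i u - m i) * (b i u - m i)"] by simp
  next
    case False
    have "(\<Sum>v\<in>W j. b j v - m j) = 0"
      using pos[OF that(2)] by (simp add: sum_subtractf m_def)
    then show ?thesis
      using False mean_two_coordinates[OF that False, where g = "\<lambda>u v. (b i u - m i) * (b j v - m j)"]
      by (simp flip: sum_distrib_left)
  qed
  have "mean I W (\<lambda>x. (\<Sum>i\<in>I. b i (x i) - m i)\<^sup>2)
      = (\<Sum>i\<in>I. \<Sum>j\<in>I. mean I W (\<lambda>x. (b i (x i) - m i) * (b j (x j) - m j)))"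
    unfolding power2_eq_square sum_product mean_sum ..
  also have "\<dots> \<le> (\<Sum>i\<in>I. \<Sum>j\<in>I. if i = j then 1 else 0)"
    using c by (intro sum_mono)
  also have "\<dots> = card I" using fin by (simp add: sum.delta)
  finally show ?thesis unfolding m_def .
qed

text \<open>Both demands are met by one \<open>x\<close> for which
  \<open>q x - 1 / \<epsilon>\<^sup>2 * (d x)\<^sup>2\<close> is at least its mean. Here
  \<open>q\<close> counts the ordered edges among the chosen vertices, and \<open>d\<close> is the
  deviation of the number of hits in the sets \<open>A i\<close> from its expectation.\<close>

lemma exists_transversal:
  fixes E :: "'a \<Rightarrow> 'a \<Rightarrow> bool" and A :: "'i \<Rightarrow> 'a set" and \<epsilon> :: real
  assumes "\<epsilon> > 0" "\<And>i. i \<in> I \<Longrightarrow> A i \<subseteq> W i"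
    and A: "(\<Sum>i\<in>I. card (A i) / card (W i)) \<ge> (1 / 2 + \<epsilon>) * card I"
    and E: "\<And>i j. i \<in> I \<Longrightarrow> j \<in> I \<Longrightarrow> i \<noteq> j \<Longrightarrow>
        card {(u, v). u \<in> W i \<and> v \<in> W j \<and> E u v} \<ge> (1 / 2 + \<epsilon>) * (card (W i) * card (W j))"
    and n: "\<epsilon> / 2 * card I \<ge> 1 / 2 + \<epsilon> + 1 / \<epsilon>\<^sup>2"
  shows "\<exists>x\<in>PiE I W. card {i \<in> I. x i \<in> A i} \<ge> card I / 2
    \<and> card {(i, j). i \<in> I \<and> j \<in> I \<and> i \<noteq> j \<and> E (x i) (x j)} \<ge> (1 / 2 + \<epsilon> / 2) * (card I * card I)"
proof -
  define b where "b i u = (of_bool (u \<in> A i) :: real)" for i u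
  define q where "q x = (\<Sum>i\<in>I. \<Sum>j\<in>I - {i}. of_bool (E (x i) (x j)) :: real)" for x :: "'i \<Rightarrow> 'a"
  define d where "d x = (\<Sum>i\<in>I. b i (x i) - (\<Sum>u\<in>W i. b i u) / card (W i))" for x
  have pos: "card (W i) > 0" if "i \<in> I" for i
    using fin ne that by (auto simp: card_gt_0_iff)
  have bsum: "(\<Sum>u\<in>W i. b i u) = card (A i)" if "i \<in> I" for i
    using assms(2)[OF that] fin that by (simp add: b_def Int_absorb1)
  have q_card: "q x = card {(i, j). i \<in> I \<and> j \<in> I \<and> i \<noteq> j \<and> E (x i) (x j)}" for x
  proof -
    have "{(i, j). i \<in> I \<and> j \<in> I \<and> i \<noteq> j \<and> E (x i) (x j)} = (SIGMA i:I. {j \<in> I - {i}. E (x i) (x j)})"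
      by auto
    then show ?thesis unfolding q_def using fin by (simp add: Int_def)
  qed
  have "mean I W q = (\<Sum>i\<in>I. \<Sum>j\<in>I - {i}. mean I W (\<lambda>x. of_bool (E (x i) (x j))))"
    unfolding q_def mean_sum ..
  also have "\<dots> \<ge> (\<Sum>i\<in>I. \<Sum>j\<in>I - {i}. 1 / 2 + \<epsilon>)"
  proof (intro sum_mono)
    fix i j assume ij: "i \<in> I" "j \<in> I - {i}"
    then have "{(u, v). u \<in> W i \<and> v \<in> W j \<and> E u v} = (SIGMA u:W i. {v \<in> W j. E u v})"
      by auto
    then have "(\<Sum>u\<in>W i. \<Sum>v\<in>W j. of_bool (E u v)) = real (card {(u, v). u \<in> W i \<and> v \<in> W j \<and> E u v})"
      using fin ij by (simp add: Int_def)
    then show "1 / 2 + \<epsilon> \<le> mean I W (\<lambda>x. of_bool (E (x i) (x j)))"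
      using mean_two_coordinates[of i j "\<lambda>u v. of_bool (E u v)"] E[of i j] ij pos[of i] pos[of j]
      by (auto simp: pos_le_divide_eq)
  qed
  finally have mq: "(\<Sum>i\<in>I. \<Sum>j\<in>I - {i}. 1 / 2 + \<epsilon>) \<le> mean I W q" .
  have count: "(\<Sum>i\<in>I. \<Sum>j\<in>I - {i}. 1 / 2 + \<epsilon>) = (1 / 2 + \<epsilon>) * (real (card I) * card I - card I)"
  proof -
    have "real (card (I - {i})) = real (card I) - 1" if "i \<in> I" for i
      using card_Suc_Diff1[OF fin(1) that] by linarith
    then have "(\<Sum>i\<in>I. \<Sum>j\<in>I - {i}. 1 / 2 + \<epsilon>) = (\<Sum>i\<in>I. (real (card I) - 1) * (1 / 2 + \<epsilon>))"
      by (intro sum.cong) (simp_all only: sum_constant)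
    also have "\<dots> = (1 / 2 + \<epsilon>) * (real (card I) * card I - card I)"
      by (simp add: field_simps)
    finally show ?thesis .
  qed
  note mq = mq[unfolded count]
  have md: "mean I W (\<lambda>x. (d x)\<^sup>2) \<le> card I"
    unfolding d_def by (rule mean_square_deviation) (auto simp: b_def)
  obtain x where x: "x \<in> PiE I W" "q x - 1 / \<epsilon>\<^sup>2 * (d x)\<^sup>2 \<ge> mean I W (\<lambda>x. q x - 1 / \<epsilon>\<^sup>2 * (d x)\<^sup>2)"
    using exists_ge_mean by blast
  have "mean I W (\<lambda>x. q x - 1 / \<epsilon>\<^sup>2 * (d x)\<^sup>2) \<ge> (1 / 2 + \<epsilon>) * (real (card I) * card I - card I) - 1 / \<epsilon>\<^sup>2 * card I"
    unfolding mean_diff mean_scale using mq md by (intro diff_mono mult_left_mono) auto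
  \<comment> \<open>Hypothesis \<open>n\<close> pays for the diagonal pairs missing from
    \<open>q\<close> and for the variance.\<close>
  moreover have "\<epsilon> / 2 * card I * card I \<ge> (1 / 2 + \<epsilon> + 1 / \<epsilon>\<^sup>2) * card I"
    using n by (intro mult_right_mono) auto
  moreover have "(1 / 2 + \<epsilon>) * (real (card I) * card I - card I) - 1 / \<epsilon>\<^sup>2 * card I
      = (1 / 2 + \<epsilon> / 2) * (card I * card I) + (\<epsilon> / 2 * card I * card I - (1 / 2 + \<epsilon> + 1 / \<epsilon>\<^sup>2) * card I)"
    using assms(1) by (simp add: field_simps)
  ultimately have main: "q x - 1 / \<epsilon>\<^sup>2 * (d x)\<^sup>2 \<ge> (1 / 2 + \<epsilon> / 2) * (card I * card I)"
    using x(2) by linarith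
  show ?thesis
  proof (intro bexI[OF _ x(1)] conjI)
    have "1 / \<epsilon>\<^sup>2 * (d x)\<^sup>2 \<ge> 0" by simp
    then show "card {(i, j). i \<in> I \<and> j \<in> I \<and> i \<noteq> j \<and> E (x i) (x j)} \<ge> (1 / 2 + \<epsilon> / 2) * (card I * card I)"
      using main unfolding q_card by linarith
    \<comment> \<open>As \<open>q x\<close> is at most the square of \<open>card I\<close>, so is
      the penalty. The weight \<open>1 / \<epsilon>\<^sup>2\<close> turns this into
      \<open>\<bar>d x\<bar> \<le> \<epsilon> * card I\<close>, a loss equal to the surplus over one
      half in hypothesis \<open>A\<close>.\<close>
    have "q x \<le> card (I \<times> I)"
      unfolding q_card using fin by (intro of_nat_mono card_mono) auto
    moreover have "(1 / 2 + \<epsilon> / 2) * (card I * card I) \<ge> 0" using assms(1) by simp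
    ultimately have "1 / \<epsilon>\<^sup>2 * (d x)\<^sup>2 \<le> (real (card I))\<^sup>2"
      using main by (simp add: card_cartesian_product power2_eq_square)
    then have "(d x)\<^sup>2 \<le> (\<epsilon> * card I)\<^sup>2"
      using assms(1) by (simp add: field_simps)
    then have "\<bar>d x\<bar> \<le> \<epsilon> * card I"
      using assms(1) by (simp flip: abs_le_square_iff)
    moreover have "d x = card {i \<in> I. x i \<in> A i} - (\<Sum>i\<in>I. card (A i) / card (W i))"
      unfolding d_def using fin by (simp add: sum_subtractf bsum) (simp add: b_def Int_def)
    ultimately show "card {i \<in> I. x i \<in> A i} \<ge> card I / 2"
      using A by (simp add: algebra_simps)
  qed
qed

end

section \<open>Cycles through a prescribed part\<close>

text \<open>The path \<open>p\<close> closes through \<open>u\<close> to a cycle on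
  \<open>l + 1\<close> vertices. Averaging over \<open>U\<close> supplies a \<open>u\<close> whose
  relative degrees into the \<open>W i\<close> average at least \<open>1 / 2 + \<epsilon>\<close>;
  its neighbourhoods serve as the sets \<open>A i\<close> of
  \<open>exists_transversal\<close>.\<close>

lemma cycle_through_part:
  fixes \<epsilon> :: real and W :: "'i \<Rightarrow> 'a set"
  assumes "\<epsilon> > 0" "l \<ge> 5"
    and n: "card I \<ge> (1 / 2 + \<epsilon> + 1 / \<epsilon>\<^sup>2) * (2 / \<epsilon>) + l * 24 / \<epsilon>"
    and fin: "finite I" "finite U" "U \<noteq> {}" and E: "symp E"
    and W: "\<And>i. i \<in> I \<Longrightarrow> finite (W i) \<and> W i \<noteq> {}"
    and dU: "\<And>i. i \<in> I \<Longrightarrow>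
      card {(u, v). u \<in> U \<and> v \<in> W i \<and> E u v} \<ge> (1 / 2 + \<epsilon>) * (card U * card (W i))"
    and dW: "\<And>i j. i \<in> I \<Longrightarrow> j \<in> I \<Longrightarrow> i \<noteq> j \<Longrightarrow>
      card {(u, v). u \<in> W i \<and> v \<in> W j \<and> E u v} \<ge> (1 / 2 + \<epsilon>) * (card (W i) * card (W j))"
  shows "\<exists>u\<in>U. \<exists>x p. length p = l \<and> distinct p \<and> set p \<subseteq> I \<and> (\<forall>i\<in>set p. x i \<in> W i) \<and>
    successively (\<lambda>i j. E (x i) (x j)) p \<and> E u (x (hd p)) \<and> E (x (last p)) u"
proof -
  have "(1 / 2 + \<epsilon> + 1 / \<epsilon>\<^sup>2) * (2 / \<epsilon>) \<ge> 0" "l * 24 / \<epsilon> > 0"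
    using assms by simp_all
  \<comment> \<open>The first summand is what \<open>exists_transversal\<close> requires. The second
    gives \<open>\<epsilon> / 2 * card I \<ge> 12 * l\<close>, above the \<open>10 * l\<close>
    needed by \<open>path_between_large_set\<close>.\<close>
  then have n1: "card I \<ge> (1 / 2 + \<epsilon> + 1 / \<epsilon>\<^sup>2) * (2 / \<epsilon>)" and n2: "card I \<ge> l * 24 / \<epsilon>"
    and "real (card I) > 0"
    using n by linarith+
  then have I: "I \<noteq> {}" "card I > 0" by auto
  have posU: "card U > 0" using fin by (simp add: card_gt_0_iff)
  have posW: "card (W i) > 0" if "i \<in> I" for i using W that by (simp add: card_gt_0_iff)
  define A where "A u i = {v \<in> W i. E u v}" for u i
  have "(\<Sum>u\<in>U. (1 / 2 + \<epsilon>) * card I) = (\<Sum>i\<in>I. (1 / 2 + \<epsilon>) * card U)"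
    by simp
  also have "\<dots> \<le> (\<Sum>i\<in>I. (\<Sum>u\<in>U. card (A u i) / card (W i)))"
  proof (intro sum_mono)
    fix i assume i: "i \<in> I"
    have "{(u, v). u \<in> U \<and> v \<in> W i \<and> E u v} = (SIGMA u:U. A u i)" by (auto simp: A_def)
    then have "real (card {(u, v). u \<in> U \<and> v \<in> W i \<and> E u v}) = (\<Sum>u\<in>U. card (A u i))"
      using fin W i by (simp add: A_def)
    then show "(1 / 2 + \<epsilon>) * card U \<le> (\<Sum>u\<in>U. card (A u i) / card (W i))"
      using dU[OF i] posW[OF i] by (simp add: pos_le_divide_eq mult.assoc flip: sum_divide_distrib)
  qed
  also have "\<dots> = (\<Sum>u\<in>U. \<Sum>i\<in>I. card (A u i) / card (W i))" by (rule sum.swap)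
  finally have "\<not> (\<Sum>u\<in>U. \<Sum>i\<in>I. card (A u i) / card (W i)) < (\<Sum>u\<in>U. (1 / 2 + \<epsilon>) * card I)"
    by simp
  then obtain u where u: "u \<in> U" "(\<Sum>i\<in>I. card (A u i) / card (W i)) \<ge> (1 / 2 + \<epsilon>) * card I"
    using sum_strict_mono[OF fin(2,3), of "\<lambda>u. \<Sum>i\<in>I. card (A u i) / card (W i)" "\<lambda>_. (1 / 2 + \<epsilon>) * card I"]
    by force
  have "\<exists>x\<in>PiE I W. card {i \<in> I. x i \<in> A u i} \<ge> card I / 2
    \<and> card {(i, j). i \<in> I \<and> j \<in> I \<and> i \<noteq> j \<and> E (x i) (x j)} \<ge> (1 / 2 + \<epsilon> / 2) * (card I * card I)"
  proof (rule exists_transversal[OF fin(1) _ _ assms(1) _ u(2)])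
    show "\<epsilon> / 2 * card I \<ge> 1 / 2 + \<epsilon> + 1 / \<epsilon>\<^sup>2"
      using n1 assms by (simp add: field_simps)
  qed (use W dW in \<open>auto simp: A_def\<close>)
  then obtain x where x: "x \<in> PiE I W" "card {i \<in> I. x i \<in> A u i} \<ge> card I / 2"
    "card {(i, j). i \<in> I \<and> j \<in> I \<and> i \<noteq> j \<and> E (x i) (x j)} \<ge> (1 / 2 + \<epsilon> / 2) * (card I * card I)"
    by blast
  \<comment> \<open>From here the graph lives on indices: a path with distinct indices uses each
    part at most once.\<close>
  define R where "R i j \<longleftrightarrow> i \<noteq> j \<and> E (x i) (x j)" for i j
  have "\<exists>p. length p = l \<and> distinct p \<and> set p \<subseteq> I \<and> successively R p
      \<and> hd p \<in> {i \<in> I. x i \<in> A u i} \<and> last p \<in> {i \<in> I. x i \<in> A u i}"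
  proof (rule path_between_large_set[where h = l])
    show "symp R" using E by (auto simp: R_def symp_def)
    have "10 * real l < \<epsilon> / 2 * card I"
      using n2 assms by (simp add: field_simps)
    then have "10 * real l * card I < \<epsilon> / 2 * card I * card I"
      using I(2) by (intro mult_strict_right_mono) auto
    moreover have "adj R I I = {(i, j). i \<in> I \<and> j \<in> I \<and> i \<noteq> j \<and> E (x i) (x j)}"
      by (auto simp: adj_def R_def)
    ultimately show "card (adj R I I) > card I * card I / 2 + 10 * real l * card I"
      using x(3) by (simp add: algebra_simps)
  qed (use fin I x assms in auto)
  then obtain p where p: "length p = l" "distinct p" "set p \<subseteq> I" "successively R p"
    "x (hd p) \<in> A u (hd p)" "x (last p) \<in> A u (last p)" by blast
  have "successively (\<lambda>i j. E (x i) (x j)) p"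
    using p(4) by (rule successively_mono) (auto simp: R_def)
  moreover have "E u (x (hd p))" "E (x (last p)) u"
    using p(5,6) E by (auto simp: A_def symp_def)
  moreover have "\<forall>i\<in>set p. x i \<in> W i" using x(1) p(3) by (auto simp: PiE_iff)
  ultimately show "\<exists>u\<in>U. \<exists>x p. length p = l \<and> distinct p \<and> set p \<subseteq> I \<and> (\<forall>i\<in>set p. x i \<in> W i) \<and>
    successively (\<lambda>i j. E (x i) (x j)) p \<and> E u (x (hd p)) \<and> E (x (last p)) u"
    using u(1) p(1-3) by blast
qed

section \<open>Tilings of uniform hypergraphs\<close>

text \<open>A perfect matching of \<open>S\<close> in the hypergraph whose edges are the sets
  satisfying \<open>H\<close>.\<close>

definition tiles :: "('a set \<Rightarrow> bool) \<Rightarrow> 'a set \<Rightarrow> 'a set set \<Rightarrow> bool" where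
  "tiles H S P \<longleftrightarrow> \<Union>P = S \<and> disjoint P \<and> (\<forall>T\<in>P. H T)"

lemma tiles_empty: "tiles H {} {}"
  by (simp add: tiles_def)

lemma tiles_Un:
  assumes "tiles H S P" "tiles H S' P'" "S \<inter> S' = {}"
  shows "tiles H (S \<union> S') (P \<union> P')"
  using assms by (auto simp: tiles_def intro!: disjoint_union)

lemma tiles_insert:
  assumes "tiles H S P" "H T" "S \<inter> T = {}"
  shows "\<exists>P'. tiles H (T \<union> S) P'"
proof -
  have "tiles H T {T}" using assms(2) by (simp add: tiles_def)
  from tiles_Un[OF this assms(1)] assms(3) show ?thesis by blast
qed

lemma tiles_card:
  assumes "finite S" "tiles H S P" "\<And>T. H T \<Longrightarrow> card T = t"
  shows "card S = card P * t"
proof -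
  have "pairwise disjnt P" "\<Union>P = S"
    using assms(2) by (auto simp: tiles_def disjoint_def pairwise_def disjnt_def)
  then have "card S = sum card P"
    using card_Union_disjoint[of P] assms(1) by (auto intro: finite_subset)
  also have "\<dots> = card P * t"
    using assms(2,3) by (simp add: tiles_def)
  finally show ?thesis .
qed

text \<open>Tiles are removed while more than \<open>n0\<close> points remain; each removal makes
  progress because tiles are nonempty.\<close>

lemma tiles_greedy:
  assumes "finite S" "S \<subseteq> M" and H: "\<And>T. H T \<Longrightarrow> T \<noteq> {}"
    and ex: "\<And>J. J \<subseteq> M \<Longrightarrow> card J > n0 \<Longrightarrow> \<exists>T\<subseteq>J. H T"
  shows "\<exists>L\<subseteq>S. card L \<le> n0 \<and> (\<exists>P. tiles H (S - L) P)"
  using assms(1,2)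
proof (induction "card S" arbitrary: S rule: less_induct)
  case less
  show ?case
  proof (cases "card S \<le> n0")
    case True
    then show ?thesis using tiles_empty[of H] by (intro exI[of _ S]) auto
  next
    case False
    then obtain T where T: "T \<subseteq> S" "H T" using ex[OF less.prems(2)] by auto
    have "card (S - T) < card S"
      using T H[OF T(2)] less.prems by (intro psubset_card_mono) auto
    from less.hyps[OF this] less.prems
    obtain L P where L: "L \<subseteq> S - T" "card L \<le> n0" "tiles H (S - T - L) P" by blast
    then obtain P' where "tiles H (T \<union> (S - T - L)) P'" using tiles_insert[OF L(3) T(2)] by auto
    moreover have "T \<union> (S - T - L) = S - L" using T L by auto
    ultimately show ?thesis using L by (metis Diff_subset subset_trans)
  qed
qed

lemma tiles_absorb:
  assumes "finite L" "finite K" "L \<inter> K = {}" "L \<union> K \<subseteq> M" "t > 0"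
    and H: "\<And>T. H T \<Longrightarrow> finite T \<and> card T = t"
    and ex: "\<And>i J. i \<in> M \<Longrightarrow> J \<subseteq> M - {i} \<Longrightarrow> card J \<ge> n0 \<Longrightarrow> \<exists>T\<subseteq>insert i J. i \<in> T \<and> H T"
    and K: "card K \<ge> n0 + t * card L"
  shows "\<exists>D\<subseteq>K. card D \<le> t * card L \<and> (\<exists>P. tiles H (L \<union> D) P)"
  using assms(1,3,4) K
proof (induction L rule: finite_induct)
  case empty
  then show ?case using tiles_empty[of H] by auto
next
  case (insert i L)
  then obtain D P where D: "D \<subseteq> K" "card D \<le> t * card L" "tiles H (L \<union> D) P" by auto
  have "finite D" using D(1) assms(2) finite_subset by blast
  then have "card (K - D) \<ge> n0"
    using D insert.prems(3) insert.hyps by (simp add: card_Diff_subset)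
  then obtain T where T: "T \<subseteq> insert i (K - D)" "i \<in> T" "H T"
    using ex[of i "K - D"] insert.prems(1,2) by auto
  have "finite T" "card T = t" using H T(3) by auto
  have "card (D \<union> (T - {i})) \<le> card D + card (T - {i})" by (rule card_Un_le)
  also have "\<dots> \<le> t * card (insert i L)"
    using D(2) insert.hyps card_mono[OF \<open>finite T\<close>, of "T - {i}"] \<open>card T = t\<close> by auto
  finally have "card (D \<union> (T - {i})) \<le> t * card (insert i L)" .
  moreover have "D \<union> (T - {i}) \<subseteq> K" using D T by auto
  moreover have "(L \<union> D) \<inter> T = {}" using T insert.prems(1) insert.hyps D(1) by auto
  then obtain P' where "tiles H (T \<union> (L \<union> D)) P'" using tiles_insert[OF D(3) T(3)] by blast
  moreover have "T \<union> (L \<union> D) = insert i L \<union> (D \<union> (T - {i}))" using T(2) by auto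
  ultimately show ?case by metis
qed

lemma tiles_complete:
  assumes "finite S" "t dvd card S" "t > 0" "\<And>T. T \<subseteq> S \<Longrightarrow> card T = t \<Longrightarrow> H T"
  shows "\<exists>P. tiles H S P"
  using assms(1,2,4)
proof (induction "card S" arbitrary: S rule: less_induct)
  case less
  show ?case
  proof (cases "S = {}")
    case True
    then show ?thesis using tiles_empty[of H] by blast
  next
    case False
    then have "t \<le> card S" using less.prems by (auto intro: dvd_imp_le simp: card_gt_0_iff)
    then obtain T where T: "T \<subseteq> S" "card T = t" "finite T"
      using obtain_subset_with_card_n by metis
    then have c: "card (S - T) = card S - t" using less.prems by (simp add: card_Diff_subset)
    then have "card (S - T) < card S" "t dvd card (S - T)"
      using assms(3) \<open>t \<le> card S\<close> less.prems(2) by (simp_all add: dvd_diff_nat)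
    then obtain P where "tiles H (S - T) P"
      using less.hyps[of "S - T"] less.prems by (metis Diff_subset finite_Diff subset_trans)
    from tiles_insert[OF this, of T] T less.prems(3)
    show ?thesis by (metis Diff_disjoint Diff_partition inf_commute)
  qed
qed

text \<open>The reserve \<open>K\<close> has \<open>n0 + t * n0\<close> points:
  \<open>t * n0\<close> to absorb up to \<open>n0\<close> leftover points, and \<open>n0\<close> so
  that \<open>ex\<close> still applies at the last of them.\<close>

lemma exists_tiling:
  assumes "t > 0" and M: "finite M" "card M \<ge> N" "t dvd card M"
    and N: "partn_lst {..<N} [n0 + 1, n0 + t * n0] t"
    and H: "\<And>T. H T \<Longrightarrow> finite T \<and> card T = t"
    and ex: "\<And>i J. i \<in> M \<Longrightarrow> J \<subseteq> M - {i} \<Longrightarrow> card J \<ge> n0 \<Longrightarrow> \<exists>T\<subseteq>insert i J. i \<in> T \<and> H T"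
  shows "\<exists>P. tiles H M P"
proof -
  have ex': "\<exists>T\<subseteq>J. H T" if J: "J \<subseteq> M" "card J > n0" for J
  proof -
    obtain i where i: "i \<in> J" using J(2) by fastforce
    have "card (J - {i}) \<ge> n0" using J(2) i by (simp add: card_Diff_singleton)
    then show ?thesis using ex[of i "J - {i}"] i J(1) by (auto simp: insert_absorb)
  qed
  obtain g where g: "inj_on g {..<N}" "g ` {..<N} \<subseteq> M"
    using card_le_inj[of "{..<N}" M] M(1,2) by auto
  \<comment> \<open>Colour 1 marks tiles, pulled back along \<open>g\<close>. A homogeneous set of
    colour 0 would have \<open>n0 + 1\<close> points, hence contain a tile by \<open>ex'\<close>; so
    the colour is 1.\<close>
  define f where "f T = (if H (g ` T) then 1 else 0 :: nat)" for T
  have "f \<in> nsets {..<N} t \<rightarrow> {..<length [n0 + 1, n0 + t * n0]}" by (auto simp: f_def)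
  with N have "\<exists>c<length [n0 + 1, n0 + t * n0].
      \<exists>B\<in>nsets {..<N} ([n0 + 1, n0 + t * n0] ! c). f ` nsets B t \<subseteq> {c}"
    unfolding partn_lst_def monochromatic_def by (rule bspec)
  then obtain c B where "c < length [n0 + 1, n0 + t * n0]"
    and c: "B \<in> nsets {..<N} ([n0 + 1, n0 + t * n0] ! c)" "f ` nsets B t \<subseteq> {c}"
    by blast
  then have "c < 2" by simp
  define K where "K = g ` B"
  have B: "B \<subseteq> {..<N}" "finite B" using c(1) by (auto simp: nsets_def)
  have inj: "inj_on g B" using g(1) B(1) inj_on_subset by blast
  have K: "K \<subseteq> M" "finite K" "card K = [n0 + 1, n0 + t * n0] ! c"
    using g B c(1) by (auto simp: K_def nsets_def card_image[OF inj])
  have mono: "H T \<longleftrightarrow> c = 1" if T: "T \<subseteq> K" "card T = t" for T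
  proof -
    obtain T' where T': "T' \<subseteq> B" "T = g ` T'" using T(1) unfolding K_def by (meson subset_imageE)
    have "inj_on g T'" using inj T'(1) inj_on_subset by blast
    then have "T' \<in> nsets B t"
      using T' T(2) B(2) by (auto simp: nsets_def card_image intro: finite_subset)
    then have "f T' = c" using c(2) by auto
    then show ?thesis using T'(2) by (auto simp: f_def split: if_splits)
  qed
  have "c = 1"
  proof (rule ccontr)
    assume "c \<noteq> 1"
    then have "card K = n0 + 1" using \<open>c < 2\<close> K(3) by (cases c) auto
    then obtain T where T: "T \<subseteq> K" "H T" using ex'[OF K(1)] by auto
    then show False using mono[OF T(1)] H[OF T(2)] \<open>c \<noteq> 1\<close> by simp
  qed
  then have cK: "card K = n0 + t * n0" using K(3) by simp
  have ne: "T \<noteq> {}" if "H T" for T using H[OF that] assms(1) by auto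
  obtain L P where L: "L \<subseteq> M - K" "card L \<le> n0" "tiles H (M - K - L) P"
    using tiles_greedy[of "M - K" M H n0, OF _ _ ne ex'] M(1) by auto
  have "\<exists>D\<subseteq>K. card D \<le> t * card L \<and> (\<exists>P. tiles H (L \<union> D) P)"
  proof (rule tiles_absorb[where M = M])
    show "card K \<ge> n0 + t * card L" using L(2) cK by simp
    show "finite L" using L(1) M(1) finite_subset by blast
  qed (use L K assms H ex in auto)
  then obtain D P' where D: "D \<subseteq> K" "tiles H (L \<union> D) P'" by blast
  have split: "M = (M - K - L) \<union> (L \<union> D) \<union> (K - D)" and
    disj: "(M - K - L) \<inter> (L \<union> D) = {}" "((M - K - L) \<union> (L \<union> D)) \<inter> (K - D) = {}"
    using D(1) K(1) L(1) by auto
  have t1: "tiles H ((M - K - L) \<union> (L \<union> D)) (P \<union> P')"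
    using tiles_Un[OF L(3) D(2) disj(1)] .
  have fin: "finite ((M - K - L) \<union> (L \<union> D))" using split M(1) by (metis finite_Un)
  have "card M = card ((M - K - L) \<union> (L \<union> D)) + card (K - D)"
    using card_Un_disjoint[OF fin _ disj(2)] K(2) split by simp
  moreover have "t dvd card ((M - K - L) \<union> (L \<union> D))"
    using tiles_card[OF fin t1] H by (metis dvd_triv_right)
  ultimately have "t dvd card (K - D)" using M(3) by (simp add: dvd_add_right_iff)
  then obtain P'' where "tiles H (K - D) P''"
    using tiles_complete[of "K - D" t H] K(2) assms(1) mono[of T for T] \<open>c = 1\<close>
    by (metis Diff_subset finite_Diff order.trans)
  from tiles_Un[OF t1 this disj(2)] show ?thesis unfolding split[symmetric] ..
qed

section \<open>Traversals of multipartite graphs\<close>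

text \<open>As the parts are disjoint, \<open>f z\<close> determines \<open>idx z\<close> and hence
  \<open>z\<close>; so \<open>f\<close> is injective and hits each part once. The image of
  \<open>F\<close> is itself the traversal, since a traversal need not be induced.\<close>

lemma has_traversalI:
  assumes "multipartite m V G" "bij_betw idx (verts F) {1..m}"
    and f: "\<And>z. z \<in> verts F \<Longrightarrow> f z \<in> V (idx z)"
    and e: "\<And>e. e \<in> edges F \<Longrightarrow> e \<subseteq> verts F \<and> f ` e \<in> edges G"
  shows "has_traversal F m V G"
proof -
  have G: "simple_graph G" "verts G = (\<Union>i\<in>{1..m}. V i)" "disjoint_family_on V {1..m}"
    using assms(1) by (auto simp: multipartite_def)
  have idx: "idx z \<in> {1..m}" if "z \<in> verts F" for z
    using assms(2) that by (auto simp: bij_betw_def)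
  have same: "i = idx z" if "z \<in> verts F" "i \<in> {1..m}" "f z \<in> V i" for z i
  proof (rule ccontr)
    assume "i \<noteq> idx z"
    then have "V i \<inter> V (idx z) = {}" using G(3) that(2) idx[OF that(1)] by (auto simp: disjoint_family_on_def)
    then show False using that f by auto
  qed
  have inj: "inj_on f (verts F)"
  proof (rule inj_onI)
    fix y z assume yz: "y \<in> verts F" "z \<in> verts F" "f y = f z"
    then have "idx y = idx z" using same[OF yz(2) idx[OF yz(1)]] f[OF yz(1)] by simp
    then show "y = z" using assms(2) yz by (auto simp: bij_betw_def inj_on_def)
  qed
  define T where "T = \<lparr>verts = f ` verts F, edges = (\<lambda>e. f ` e) ` edges F\<rparr>"
  have sub: "verts T \<subseteq> verts G" using f idx unfolding T_def G(2) by fastforce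
  have "finite (verts T)" using sub G(1) finite_subset by (auto simp: simple_graph_def)
  moreover have "e \<subseteq> verts T \<and> card e = 2" if "e \<in> edges T" for e
    using that e G(1) unfolding T_def simple_graph_def by fastforce
  ultimately have T: "simple_graph T" by (simp add: simple_graph_def)
  have "subgraph T G" using T sub e by (auto simp: subgraph_def T_def)
  moreover have "\<exists>!v. v \<in> verts T \<inter> V i" if i: "i \<in> {1..m}" for i
  proof -
    obtain z where z: "z \<in> verts F" "idx z = i"
      using i bij_betw_imp_surj_on[OF assms(2)] by (metis imageE)
    show ?thesis
    proof (rule ex1I[of _ "f z"])
      show "f z \<in> verts T \<inter> V i" using z f[OF z(1)] by (auto simp: T_def)
      fix v assume "v \<in> verts T \<inter> V i"
      then obtain y where y: "y \<in> verts F" "v = f y" "f y \<in> V i" by (auto simp: T_def)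
      then have "idx y = idx z" using same[OF y(1) i] z by simp
      then show "v = f z" using assms(2) y z by (auto simp: bij_betw_def inj_on_def)
    qed
  qed
  ultimately have "traversal m V G T" by (simp add: traversal_def)
  moreover have "isomorphic F T" unfolding isomorphic_def T_def
    using inj by (intro exI[of _ f]) (auto simp: bij_betw_def)
  then have "contains_copy F T" using T by (auto simp: contains_copy_def subgraph_def)
  ultimately show ?thesis by (auto simp: has_traversal_def)
qed

text \<open>Passes from unordered edges with \<open>i < j\<close> to ordered pairs with
  \<open>i \<noteq> j\<close>: disjoint parts make the map from \<open>(u, v)\<close> to
  \<open>{u, v}\<close> injective, and the count is symmetric.\<close>

lemma multipartite_pair_density:
  fixes c :: real
  assumes "multipartite m V G" "partite_density m V G \<ge> c" "i \<in> {1..m}" "j \<in> {1..m}" "i \<noteq> j"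
  shows "card {(u, v). u \<in> V i \<and> v \<in> V j \<and> {u, v} \<in> edges G} \<ge> c * (card (V i) * card (V j))"
  using assms(3-5)
proof (induction i j rule: linorder_wlog)
  case (le i j)
  then have ij: "1 \<le> i" "i < j" "j \<le> m" by auto
  have V: "V i \<inter> V j = {}" "finite (V k)" "V k \<noteq> {}" if "k \<in> {1..m}" for k
    using assms(1) le that by (auto simp: multipartite_def simple_graph_def disjoint_family_on_def)
  then have pos: "card (V i) > 0" "card (V j) > 0" using le by (simp_all add: card_gt_0_iff)
  let ?D = "{edge_density G (V i) (V j) | i j. 1 \<le> i \<and> i < j \<and> j \<le> m}"
  have "?D \<subseteq> (\<lambda>(i, j). edge_density G (V i) (V j)) ` ({1..m} \<times> {1..m})"
    by force
  then have "finite ?D" by (rule finite_subset) simp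
  moreover have "edge_density G (V i) (V j) \<in> ?D" using ij by blast
  ultimately have "partite_density m V G \<le> edge_density G (V i) (V j)"
    unfolding partite_density_def by (rule Min_le)
  then have "c \<le> edge_density G (V i) (V j)" using assms(2) by linarith
  moreover have "edges_between G (V i) (V j) =
      (\<lambda>(u, v). {u, v}) ` {(u, v). u \<in> V i \<and> v \<in> V j \<and> {u, v} \<in> edges G}"
    by (auto simp: edges_between_def)
  moreover have "inj_on (\<lambda>(u, v). {u, v}) {(u, v). u \<in> V i \<and> v \<in> V j \<and> {u, v} \<in> edges G}"
    using V(1)[OF le(2)] by (auto simp: inj_on_def doubleton_eq_iff)
  ultimately show ?case
    using pos by (simp add: edge_density_def card_image pos_le_divide_eq)
next
  case (sym j i)
  have "card {(u, v). u \<in> V i \<and> v \<in> V j \<and> {u, v} \<in> edges G}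
      = card {(u, v). u \<in> V j \<and> v \<in> V i \<and> {u, v} \<in> edges G}"
    using card_adj_swap[of "\<lambda>u v. {u, v} \<in> edges G" "V i" "V j"]
    by (simp add: adj_def symp_def insert_commute)
  then show ?case using sym by (simp add: mult.commute)
qed

section \<open>Cycle transversals and the upper bound\<close>

text \<open>\<open>l\<close> lists the parts in cyclic order and \<open>x\<close> picks their
  vertices. As a predicate on sets of part indices, it can serve as the \<open>H\<close> of
  \<open>tiles\<close>.\<close>

definition cycle_transversal :: "nat \<Rightarrow> ('i \<Rightarrow> 'a set) \<Rightarrow> ('a \<Rightarrow> 'a \<Rightarrow> bool) \<Rightarrow> 'i set \<Rightarrow> bool" where
  "cycle_transversal t V E T \<longleftrightarrow> (\<exists>l x. length l = t \<and> distinct l \<and> set l = T \<and> (\<forall>i\<in>T. x i \<in> V i) \<and>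
     (\<forall>k<t. E (x (l ! k)) (x (l ! ((k + 1) mod t)))))"

lemma cycle_transversalI:
  assumes "p \<noteq> []" "distinct p" "i \<notin> set p" "u \<in> V i" "\<forall>j\<in>set p. x j \<in> V j"
    "successively (\<lambda>j k. E (x j) (x k)) p" "E u (x (hd p))" "E (x (last p)) u"
  shows "cycle_transversal (Suc (length p)) V E (insert i (set p))"
  unfolding cycle_transversal_def
proof (intro exI conjI)
  show "\<forall>k<Suc (length p). E ((x(i := u)) ((i # p) ! k)) ((x(i := u)) ((i # p) ! ((k + 1) mod Suc (length p))))"
  proof (intro allI impI)
    fix k assume k: "k < Suc (length p)"
    have x: "(x(i := u)) (p ! j) = x (p ! j)" if "j < length p" for j
      using that assms(3) nth_mem by fastforce
    \<comment> \<open>The edge leaving \<open>u\<close>, the edge returning to \<open>u\<close>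
      where the modulus wraps round, and the edges of \<open>p\<close>.\<close>
    consider "k = 0" | "k = length p" | j where "k = Suc j" "Suc j < length p"
      using k by (cases k) (auto simp: less_Suc_eq)
    then show "E ((x(i := u)) ((i # p) ! k)) ((x(i := u)) ((i # p) ! ((k + 1) mod Suc (length p))))"
    proof cases
      case 1
      then show ?thesis using assms(1,7) x[of 0] by (simp add: hd_conv_nth)
    next
      case 2
      then show ?thesis using assms(1,8) x[of "length p - 1"] by (simp add: last_conv_nth nth_Cons')
    next
      case 3
      then show ?thesis using assms(6) x[of j] x[of "Suc j"] by (simp add: successively_conv_nth)
    qed
  qed
qed (use assms in auto)

lemma dense_has_traversal:
  fixes \<epsilon> :: real
  assumes "\<epsilon> > 0" "t \<ge> 6"
  shows "\<exists>r0. \<forall>r\<ge>r0. \<forall>(G :: 'a graph) V. multipartite (r * t) V G \<and> partite_density (r * t) V G \<ge> 1 / 2 + \<epsilon>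
    \<longrightarrow> has_traversal (disjoint_copies r (cycle_graph t)) (r * t) V G"
proof -
  \<comment> \<open>The threshold of \<open>cycle_through_part\<close> for paths on
    \<open>t - 1\<close> vertices; the prescribed part supplies the last vertex of the cycle. Both
    \<open>n0\<close> and \<open>N\<close> are fixed before \<open>G\<close>, so the bound on
    \<open>r\<close> is uniform.\<close>
  obtain n0 :: nat where n0: "n0 > (1 / 2 + \<epsilon> + 1 / \<epsilon>\<^sup>2) * (2 / \<epsilon>) + real (t - 1) * 24 / \<epsilon>"
    using reals_Archimedean2 by blast
  have "t > 0" using assms by simp
  obtain N :: nat where N: "partn_lst {..<N} [n0 + 1, n0 + t * n0] t"
    using ramsey_full[of "[n0 + 1, n0 + t * n0]" t] ..
  show ?thesis
  proof (intro exI[of _ N] allI impI, elim conjE)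
    fix r V and G :: "'a graph"
    assume r: "N \<le> r" and G: "multipartite (r * t) V G" "partite_density (r * t) V G \<ge> 1 / 2 + \<epsilon>"
    define E where "E u v \<longleftrightarrow> {u, v} \<in> edges G" for u v
    let ?M = "{1..r * t}"
    let ?H = "cycle_transversal t V E"
    have V: "finite (V i) \<and> V i \<noteq> {}" if "i \<in> ?M" for i
      using G(1) that unfolding multipartite_def simple_graph_def by (metis UN_upper finite_subset)
    have dens: "card {(u, v). u \<in> V i \<and> v \<in> V j \<and> E u v} \<ge> (1 / 2 + \<epsilon>) * (card (V i) * card (V j))"
      if "i \<in> ?M" "j \<in> ?M" "i \<noteq> j" for i j
      using multipartite_pair_density[OF G that] by (simp add: E_def)
    have H: "finite T \<and> card T = t" if "?H T" for T
      using that by (auto simp: cycle_transversal_def distinct_card)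
    have "\<exists>T\<subseteq>insert i J. i \<in> T \<and> ?H T" if i: "i \<in> ?M" and J: "J \<subseteq> ?M - {i}" "card J \<ge> n0" for i J
    proof -
      have "finite J" using J(1) finite_subset by blast
      then have "\<exists>u\<in>V i. \<exists>x p. length p = t - 1 \<and> distinct p \<and> set p \<subseteq> J \<and> (\<forall>i\<in>set p. x i \<in> V i) \<and>
        successively (\<lambda>i j. E (x i) (x j)) p \<and> E u (x (hd p)) \<and> E (x (last p)) u"
      proof (rule cycle_through_part[OF assms(1), rotated 2])
        show "card J \<ge> (1 / 2 + \<epsilon> + 1 / \<epsilon>\<^sup>2) * (2 / \<epsilon>) + real (t - 1) * 24 / \<epsilon>"
          using n0 J(2) by linarith
        show "symp E" by (auto simp: symp_def E_def insert_commute)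
        show "(1 / 2 + \<epsilon>) * (card (V i) * card (V j)) \<le> card {(u, v). u \<in> V i \<and> v \<in> V j \<and> E u v}"
          if "j \<in> J" for j
        proof -
          have "j \<in> ?M" "i \<noteq> j" using J(1) that by auto
          then show ?thesis using dens[OF i] by blast
        qed
        show "(1 / 2 + \<epsilon>) * (card (V k) * card (V j)) \<le> card {(u, v). u \<in> V k \<and> v \<in> V j \<and> E u v}"
          if "k \<in> J" "j \<in> J" "k \<noteq> j" for k j
        proof -
          have "k \<in> ?M" "j \<in> ?M" using J(1) that by auto
          then show ?thesis using dens that(3) by blast
        qed
      qed (use V i J(1) assms(2) in auto)
      then obtain u x p where p: "u \<in> V i" "length p = t - 1" "distinct p" "set p \<subseteq> J" "\<forall>i\<in>set p. x i \<in> V i"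
        "successively (\<lambda>i j. E (x i) (x j)) p" "E u (x (hd p))" "E (x (last p)) u" by blast
      have "p \<noteq> []" "i \<notin> set p" "Suc (length p) = t" using p(2,4) assms(2) J(1) by auto
      then have "?H (insert i (set p))"
        using cycle_transversalI[of p i u V x E] p by simp
      then show ?thesis using p(4) by (intro exI[of _ "insert i (set p)"]) auto
    qed
    moreover have "N \<le> card ?M" using r \<open>t > 0\<close> by (simp add: le_trans[of N r])
    ultimately obtain P where P: "tiles ?H ?M P"
      using exists_tiling[OF \<open>t > 0\<close> _ _ _ N, of ?M ?H] H r by auto
    have fin: "finite P"
      using P unfolding tiles_def by (metis finite_UnionD finite_atLeastAtMost)
    \<comment> \<open>Tiles of \<open>t\<close> parts exhaust the \<open>r * t\<close> parts, so
      there are exactly \<open>r\<close> of them, one for each copy of the cycle.\<close>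
    have "card ?M = card P * t"
      by (rule tiles_card[OF _ P]) (use H in auto)
    then have "card P = r" using assms(2) by simp
    then obtain b where b: "bij_betw b {0..<r} P"
      using ex_bij_betw_nat_finite[OF fin] by blast
    have "\<forall>k\<in>{0..<r}. ?H (b k)" using b P by (auto simp: tiles_def bij_betw_def)
    then obtain l x where lx: "\<And>k. k < r \<Longrightarrow> length (l k) = t \<and> distinct (l k) \<and> set (l k) = b k
        \<and> (\<forall>i\<in>b k. x k i \<in> V i) \<and> (\<forall>j<t. E (x k (l k ! j)) (x k (l k ! ((j + 1) mod t))))"
      unfolding cycle_transversal_def by (metis atLeastLessThan_iff zero_le)
    \<comment> \<open>Vertex \<open>j\<close> of copy \<open>k\<close> is sent to the
      \<open>j\<close>-th part of tile \<open>k\<close>, and to the vertex chosen there.\<close>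
    define idx where "idx = (\<lambda>(k, j). l k ! j)"
    define f where "f = (\<lambda>(k, j). x k (l k ! j))"
    show "has_traversal (disjoint_copies r (cycle_graph t)) (r * t) V G"
    proof (rule has_traversalI[OF G(1), where idx = idx and f = f])
      let ?F = "disjoint_copies r (cycle_graph t)"
      have F: "verts ?F = {0..<r} \<times> {0..<t}"
        by (simp add: disjoint_copies_def cycle_graph_def)
      have "inj_on idx ({0..<r} \<times> {0..<t})"
      proof (rule inj_onI)
        fix y z assume y: "y \<in> {0..<r} \<times> {0..<t}" and z: "z \<in> {0..<r} \<times> {0..<t}" and eq: "idx y = idx z"
        obtain k j k' j' where yz: "y = (k, j)" "z = (k', j')" by fastforce
        then have kj: "k < r" "j < t" "k' < r" "j' < t" using y z by auto
        then have "idx y \<in> b k" "idx z \<in> b k'" using lx[of k] lx[of k'] yz by (auto simp: idx_def)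
        \<comment> \<open>Distinct tiles are disjoint, so a shared part identifies the tile; within
          it the list \<open>l k\<close> has no repetition.\<close>
        then have "b k = b k'"
          using eq P b kj unfolding tiles_def disjoint_def bij_betw_def by (metis IntI atLeastLessThan_iff empty_iff image_eqI zero_le)
        then have "k = k'" using b kj by (auto simp: bij_betw_def inj_on_def)
        then show "y = z" using eq yz kj lx[of k] by (auto simp: idx_def nth_eq_iff_index_eq)
      qed
      moreover have "idx ` ({0..<r} \<times> {0..<t}) = ?M"
      proof -
        have "idx ` ({0..<r} \<times> {0..<t}) = (\<Union>k\<in>{0..<r}. (\<lambda>j. l k ! j) ` {0..<t})"
          by (auto simp: idx_def)
        also have "\<dots> = (\<Union>k\<in>{0..<r}. b k)"
        proof (rule SUP_cong)
          show "(\<lambda>j. l k ! j) ` {0..<t} = b k" if "k \<in> {0..<r}" for k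
            using lx[of k] that nth_image[of t "l k"] by simp
        qed simp
        also have "\<dots> = ?M" using b P by (auto simp: tiles_def bij_betw_def)
        finally show ?thesis .
      qed
      ultimately show "bij_betw idx (verts ?F) ?M" by (simp add: F bij_betw_def)
      show "f z \<in> V (idx z)" if zF: "z \<in> verts ?F" for z
      proof -
        obtain k j where z: "z = (k, j)" "k < r" "j < t" using zF unfolding F by auto
        then have "l k ! j \<in> b k" using lx[of k] nth_mem[of j "l k"] by simp
        then show ?thesis using lx[of k] z by (simp add: f_def idx_def)
      qed
      fix e assume "e \<in> edges ?F"
      then obtain k j where kj: "k < r" "j < t" "e = {(k, j), (k, (j + 1) mod t)}"
        by (auto simp: disjoint_copies_def cycle_graph_def)
      then show "e \<subseteq> verts ?F \<and> f ` e \<in> edges G"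
        using lx[of k] \<open>t > 0\<close> by (auto simp: F f_def E_def)
    qed
  qed
qed

section \<open>The lower bound\<close>

text \<open>Part \<open>i\<close> is \<open>{2 * i, 2 * i + 1}\<close>, and edges join even to odd
  numbers in different parts: two of the four pairs between any two parts.\<close>

lemma balanced_bipartite_multipartite:
  assumes "m \<ge> 2"
  shows "\<exists>(G :: nat graph) V. multipartite m V G \<and> partite_density m V G \<ge> 1 / 2 \<and>
    (\<forall>u v. {u, v} \<in> edges G \<longrightarrow> even u \<noteq> even v)"
proof -
  define V :: "nat \<Rightarrow> nat set" where "V i = {2 * i, 2 * i + 1}" for i
  define G where "G = \<lparr>verts = (\<Union>i\<in>{1..m}. V i),
     edges = {{2 * i, 2 * j + 1} | i j. i \<in> {1..m} \<and> j \<in> {1..m} \<and> i \<noteq> j}\<rparr>"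
  have "multipartite m V G"
    unfolding multipartite_def
  proof (intro conjI ballI allI)
    show "simple_graph G" by (auto simp: simple_graph_def G_def V_def card_insert_if)
    show "disjoint_family_on V {1..m}" by (auto simp: disjoint_family_on_def V_def)
    fix e i assume "e \<in> edges G"
    then show "\<not> e \<subseteq> V i" by (auto simp: G_def V_def) presburger+
  qed (auto simp: G_def V_def)
  moreover have "partite_density m V G \<ge> 1 / 2"
  proof -
    let ?D = "{edge_density G (V i) (V j) | i j. 1 \<le> i \<and> i < j \<and> j \<le> m}"
    have "?D \<subseteq> (\<lambda>(i, j). edge_density G (V i) (V j)) ` ({1..m} \<times> {1..m})"
      by force
    then have "finite ?D" by (rule finite_subset) simp
    moreover have "edge_density G (V 1) (V 2) \<in> ?D" using assms by force
    then have "?D \<noteq> {}" by blast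
    moreover have "edge_density G (V i) (V j) \<ge> 1 / 2" if "1 \<le> i" "i < j" "j \<le> m" for i j
    proof -
      have sub: "{{2 * i, 2 * j + 1}, {2 * j, 2 * i + 1}} \<subseteq> edges_between G (V i) (V j)"
      proof -
        have e: "{2 * i', 2 * j' + 1} \<in> edges G" if "i' \<in> {1..m}" "j' \<in> {1..m}" "i' \<noteq> j'" for i' j'
          using that unfolding G_def by auto
        have "{2 * i, 2 * j + 1} \<in> edges G" "{2 * j, 2 * i + 1} \<in> edges G"
          using that by (intro e; simp)+
        moreover have "{2 * j, 2 * i + 1} = {2 * i + 1, 2 * j}" by (rule insert_commute)
        ultimately show ?thesis unfolding edges_between_def V_def by auto
      qed
      have "edges_between G (V i) (V j) \<subseteq> Pow (V i \<union> V j)" by (auto simp: edges_between_def)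
      then have "finite (edges_between G (V i) (V j))" by (rule finite_subset) (simp add: V_def)
      from card_mono[OF this sub] have "2 \<le> card (edges_between G (V i) (V j))"
        using that by (auto simp: doubleton_eq_iff split: if_splits)
      moreover have "card (V k) = 2" for k by (simp add: V_def)
      ultimately show ?thesis by (simp add: edge_density_def)
    qed
    ultimately show ?thesis unfolding partite_density_def by (subst Min_ge_iff) auto
  qed
  moreover have "\<forall>u v. {u, v} \<in> edges G \<longrightarrow> even u \<noteq> even v"
    by (auto simp: G_def doubleton_eq_iff)
  ultimately show ?thesis by blast
qed

text \<open>Parity alternates along copy 0 of the cycle. Since \<open>t - 1\<close> is even, the
  vertices 0 and \<open>t - 1\<close> get the same parity, yet the closing edge joins them.\<close>

lemma bipartite_no_odd_cycle_traversal:
  assumes "r \<ge> 1" "t \<ge> 3" "odd t" and G: "\<And>u v. {u, v} \<in> edges G \<Longrightarrow> even u \<noteq> even (v :: nat)"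
  shows "\<not> has_traversal (disjoint_copies r (cycle_graph t)) m V G"
proof
  let ?F = "disjoint_copies r (cycle_graph t)"
  assume "has_traversal ?F m V G"
  then obtain T K f where "traversal m V G T" "subgraph K T" "edges K = (\<lambda>e. f ` e) ` edges ?F"
    unfolding has_traversal_def contains_copy_def isomorphic_def by blast
  then have edge: "f ` e \<in> edges G" if "e \<in> edges ?F" for e
    using that by (auto simp: traversal_def subgraph_def)
  have alt: "even (f (0, j)) \<noteq> even (f (0, (j + 1) mod t))" if "j < t" for j
  proof -
    have "Pair 0 ` {j, (j + 1) mod t} \<in> edges ?F"
    proof -
      have "{j, (j + 1) mod t} \<in> edges (cycle_graph t)"
        using that unfolding cycle_graph_def by auto
      moreover have "0 < r" using assms(1) by simp
      ultimately show ?thesis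
        unfolding disjoint_copies_def by (simp only: graph.simps mem_Collect_eq) blast
    qed
    from edge[OF this] show ?thesis by (intro G) simp
  qed
  have "even (f (0, j)) \<longleftrightarrow> (even j \<longleftrightarrow> even (f (0, 0)))" if "j < t" for j
    using that
  proof (induction j)
    case (Suc j)
    then show ?case using alt[of j] by auto
  qed simp
  from this[of "t - 1"] show False using alt[of "t - 1"] assms(2,3) by auto
qed

section \<open>Convergence of the critical densities\<close>

theorem theorem1p6:
  fixes t :: nat
  assumes "t \<ge> 7" and "odd t"
  shows "(\<lambda>r. critical_density (r * t) (disjoint_copies r (cycle_graph t))) \<longlonglongrightarrow> 1 / 2"
proof (rule LIMSEQ_I)
  fix \<epsilon> :: real assume "\<epsilon> > 0"
  \<comment> \<open>Taking \<open>\<epsilon> / 2\<close> here leaves the final inequality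
    strict.\<close>
  then obtain r0 where r0: "\<And>r (G :: nat graph) V. r \<ge> r0 \<Longrightarrow> multipartite (r * t) V G \<Longrightarrow>
      partite_density (r * t) V G \<ge> 1 / 2 + \<epsilon> / 2 \<Longrightarrow>
      has_traversal (disjoint_copies r (cycle_graph t)) (r * t) V G"
    using dense_has_traversal[of "\<epsilon> / 2" t, where 'a = nat] assms by auto
  show "\<exists>no. \<forall>r\<ge>no. norm (critical_density (r * t) (disjoint_copies r (cycle_graph t)) - 1 / 2) < \<epsilon>"
  \<comment> \<open>\<open>r \<ge> 1\<close> provides a first copy of the cycle and at least two
    parts, so that \<open>partite_density\<close> is meaningful.\<close>
  proof (intro exI[of _ "max r0 1"] allI impI)
    fix r assume r: "r \<ge> max r0 1"
    let ?F = "disjoint_copies r (cycle_graph t)"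
    let ?S = "{\<alpha> \<in> {0..1::real}. \<exists>(G :: nat graph) V.
        multipartite (r * t) V G \<and> partite_density (r * t) V G \<ge> \<alpha> \<and> \<not> has_traversal ?F (r * t) V G}"
    have "r * t \<ge> 1 * 7" using r assms(1) by (intro mult_le_mono) auto
    then have "r * t \<ge> 2" by simp
    then obtain G V where "multipartite (r * t) V G" "partite_density (r * t) V G \<ge> 1 / 2"
      "\<And>u v. {u, v} \<in> edges G \<Longrightarrow> even u \<noteq> even (v :: nat)"
      using balanced_bipartite_multipartite by blast
    \<comment> \<open>This member gives the lower bound, and also the nonemptiness needed to bound
      the supremum from above.\<close>
    then have half: "1 / 2 \<in> ?S"
      using bipartite_no_odd_cycle_traversal[of r t G "r * t" V] r assms by auto
    have "bdd_above ?S" by (rule bdd_aboveI[of _ 1]) auto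
    with half have "1 / 2 \<le> Sup ?S" by (rule cSup_upper)
    moreover have "Sup ?S \<le> 1 / 2 + \<epsilon> / 2"
    proof (rule cSup_least)
      fix \<alpha> assume "\<alpha> \<in> ?S"
      then obtain G :: "nat graph" and V where "multipartite (r * t) V G" "partite_density (r * t) V G \<ge> \<alpha>"
        "\<not> has_traversal ?F (r * t) V G" by blast
      then show "\<alpha> \<le> 1 / 2 + \<epsilon> / 2" using r0[of r V G] r by force
    qed (use half in blast)
    ultimately show "norm (critical_density (r * t) ?F - 1 / 2) < \<epsilon>"
      using \<open>\<epsilon> > 0\<close> unfolding critical_density_def by auto
  qed
qed

end
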